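(* For every $\epsilon>0$, almost surely $$M_f(T)\ll (\log T)^{1/2+\epsilon};$$ that is, with probability $1$ there is a (random, possibly $\epsilon$-dependent) finite constant $K$ such that $|M_f(T)|\leq K(\log T)^{1/2+\epsilon}$ for all $T\geq 2$.
   Context: Steinhaus random multiplicative function: let $(f(p))_p$, indexed by the primes, be independent random variables each uniformly distributed on the unit circle in $\mathbb{C}$, and set $f(n)=\prod_{p^{v_p}\| n}f(p)^{v_p}$ for $n\in\mathbb{N}$. Put $M_f(T)=\sum_{n\leq T}f(n)/\sqrt n$. *)

theory Defs
  imports "HOL-Probability.Probability" "HOL-Computational_Algebra.Primes"
begin

text \<open>The uniform distribution on the unit circle is the law of \<open>cis \<theta>\<close> with \<open>\<theta>\<close> uniform on
  \<open>[0, 2\<pi>]\<close>; it is a measure on the Borel sets of the whole complex plane.\<close>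

definition uniform_circle :: "complex measure" where
  "uniform_circle = distr (uniform_measure lborel {0..2 * pi}) borel cis"

lemma sets_uniform_circle [simp]: "sets uniform_circle = sets borel"
  by (simp add: uniform_circle_def)

lemma cis_borel_measurable:
  "cis \<in> borel_measurable borel"
  "cis \<in> borel_measurable (uniform_measure lborel A)"
proof -
  show *: "cis \<in> borel_measurable borel"
    by (intro borel_measurable_continuous_onI continuous_intros)
  show "cis \<in> borel_measurable (uniform_measure lborel A)"
    using * by (subst measurable_cong_sets[where M' = borel and N' = borel]) simp_all
qed

lemma prob_space_uniform_circle: "prob_space uniform_circle"
proof -
  have "prob_space (uniform_measure lborel {0..2 * pi})"
    by (intro prob_space_uniform_measure) auto
  then show ?thesis
    unfolding uniform_circle_def
    by (rule prob_space.prob_space_distr) (simp add: cis_borel_measurable)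
qed

lemma AE_uniform_circle: "AE z in uniform_circle. norm z = 1"
  unfolding uniform_circle_def
  by (subst AE_distr_iff) (simp_all add: cis_borel_measurable)

text \<open>The family \<open>X\<close> is only used at primes. The value at \<open>n = 0\<close> is irrelevant, as the sums below
  start at \<open>n = 1\<close>.\<close>

definition multiplicative_extension :: "(nat \<Rightarrow> complex) \<Rightarrow> nat \<Rightarrow> complex" where
  "multiplicative_extension X n = (\<Prod>p\<in>prime_factors n. X p ^ multiplicity p n)"

definition weighted_partial_sum :: "(nat \<Rightarrow> complex) \<Rightarrow> real \<Rightarrow> complex" where
  "weighted_partial_sum f T = (\<Sum>n | 0 < n \<and> real n \<le> T. f n / complex_of_real (sqrt (real n)))"

end

theory Submission
  imports Defs
begin

text \<open>The interval up to \<open>T\<close> is cut at the powers of two. The values at the points \<open>2 ^ t\<close> are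
  controlled by a Rademacher-Menshov chaining over dyadic blocks of exponents \<open>t\<close>: there second moments
  suffice, as the loss is only logarithmic in \<open>t\<close>, that is, in \<open>ln T\<close>. Inside a block from \<open>2 ^ j\<close> to
  \<open>2 ^ (j + 1)\<close> the same chaining with second moments would lose a factor \<open>j\<^sup>2\<close>, so fourth moments
  are used: since \<open>f\<close> is completely multiplicative, they are governed by the number of solutions of
  \<open>m n = a b\<close> in an interval of length \<open>y\<close>, which is \<open>O(y\<^sup>2 log y)\<close>. Chaining then bounds the fourth
  moment of the maximum over the block by \<open>O(j)\<close>, whereas the fourth power of the target is
  \<open>j powr (2 + 4 * \<epsilon>)\<close>, so the bounds can be summed over \<open>j\<close>.\<close>

section \<open>Dyadic chaining and almost sure domination\<close>

text \<open>Erase the binary digits of \<open>t\<close> one by one from the lowest: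
  \<open>c k\<close> is \<open>t\<close> with its last \<open>k\<close> digits set to 0, and the
  path from \<open>c 0 = t\<close> to \<open>c r = 0\<close> telescopes with at most one dyadic
  increment per level.\<close>

lemma dyadic_chaining:
  fixes S :: "nat \<Rightarrow> 'a::real_normed_vector"
  assumes incr: "\<And>k i. k < r \<Longrightarrow> (i + 1) * 2 ^ k \<le> t \<Longrightarrow> norm (S ((i + 1) * 2 ^ k) - S (i * 2 ^ k)) \<le> B k"
    and B: "\<And>k. B k \<ge> 0" and t: "t < 2 ^ r"
  shows "norm (S t - S 0) \<le> (\<Sum>k<r. B k)"
proof -
  define c where "c k = (t div 2 ^ k) * 2 ^ k" for k
  have "c 0 = t" "c r = 0"
    using t by (simp_all add: c_def)
  then have "S t - S 0 = (\<Sum>k<r. S (c k) - S (c (Suc k)))"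
    using sum_lessThan_telescope'[of "\<lambda>k. S (c k)" r] by simp
  also have "norm \<dots> \<le> (\<Sum>k<r. B k)"
  proof (rule sum_norm_le)
    fix k assume "k \<in> {..<r}"
    define u where "u = t div 2 ^ k"
    have c1: "c k = u * 2 ^ k"
      by (simp add: c_def u_def)
    have c2: "c (Suc k) = (u div 2) * 2 * 2 ^ k"
      by (simp add: c_def u_def power_Suc2 div_mult2_eq del: power_Suc)
    have le: "u * 2 ^ k \<le> t"
      by (simp add: u_def)
    \<comment> \<open>A digit 0 leaves the point unchanged, which costs nothing as
      \<open>B k\<close> is nonnegative. A digit 1 is the increment with
      \<open>i = (u div 2) * 2\<close>.\<close>
    show "norm (S (c k) - S (c (Suc k))) \<le> B k"
    proof (cases "even u")
      case True
      then show ?thesis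
        using B by (simp add: c1 c2)
    next
      case False
      then have "u = (u div 2) * 2 + 1"
        by presburger
      then show ?thesis
        using incr[of k "(u div 2) * 2"] le c1 c2 \<open>k \<in> _\<close> by simp
    qed
  qed
  finally show ?thesis .
qed

text \<open>The sum of all \<open>Y a b / l a b\<close> has expectation at most the product of the
  sums of \<open>g\<close> and \<open>h\<close>, so it is almost surely finite; its value serves as
  one constant for all \<open>a\<close> and \<open>b\<close>. This takes the place of Markov's
  inequality with Borel-Cantelli.\<close>

lemma AE_weighted_bound:
  fixes Y :: "nat \<Rightarrow> nat \<Rightarrow> 'a \<Rightarrow> real"
  assumes meas: "\<And>a b. Y a b \<in> borel_measurable M"
    and l: "\<And>a b. l a b > 0" and g0: "\<And>a. g a \<ge> 0" and h0: "\<And>b. h b \<ge> 0"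
    and le: "\<And>a b. (\<integral>\<^sup>+\<omega>. ennreal (Y a b \<omega>) \<partial>M) \<le> ennreal (g a * h b * l a b)"
    and g: "summable g" and h: "summable h"
  shows "AE \<omega> in M. \<exists>K\<ge>0. \<forall>a b. Y a b \<omega> \<le> K * l a b"
proof -
  define Z where "Z \<omega> = (\<Sum>a. \<Sum>b. ennreal (Y a b \<omega> / l a b))" for \<omega>
  have [measurable]: "Y a b \<in> borel_measurable M" for a b
    by (rule meas)
  have [measurable]: "Z \<in> borel_measurable M"
    unfolding Z_def by measurable
  have term_le: "(\<integral>\<^sup>+\<omega>. ennreal (Y a b \<omega> / l a b) \<partial>M) \<le> ennreal (g a) * ennreal (h b)" for a b
  proof -
    have "(\<integral>\<^sup>+\<omega>. ennreal (Y a b \<omega> / l a b) \<partial>M) = (\<integral>\<^sup>+\<omega>. ennreal (1 / l a b) * ennreal (Y a b \<omega>) \<partial>M)"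
      using l[of a b] by (intro nn_integral_cong) (simp add: ennreal_mult'[symmetric])
    also have "\<dots> = ennreal (1 / l a b) * (\<integral>\<^sup>+\<omega>. ennreal (Y a b \<omega>) \<partial>M)"
      by (intro nn_integral_cmult) measurable
    also have "\<dots> \<le> ennreal (1 / l a b) * ennreal (g a * h b * l a b)"
      by (intro mult_left_mono le) simp
    also have "\<dots> = ennreal (g a) * ennreal (h b)"
      using l[of a b] g0 h0 by (simp add: ennreal_mult'[symmetric])
    finally show ?thesis .
  qed
  have "(\<integral>\<^sup>+\<omega>. Z \<omega> \<partial>M) = (\<Sum>a. \<Sum>b. \<integral>\<^sup>+\<omega>. ennreal (Y a b \<omega> / l a b) \<partial>M)"
    unfolding Z_def by (simp add: nn_integral_suminf)
  also have "\<dots> \<le> (\<Sum>a. \<Sum>b. ennreal (g a) * ennreal (h b))"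
    by (intro suminf_le term_le summableI)
  also have "\<dots> = (\<Sum>a. ennreal (g a)) * (\<Sum>b. ennreal (h b))"
    by simp
  also have "\<dots> < \<infinity>"
    using ennreal_suminf_neq_top[OF g g0] ennreal_suminf_neq_top[OF h h0]
    by (simp add: ennreal_mult_less_top less_top)
  finally have "(\<integral>\<^sup>+\<omega>. Z \<omega> \<partial>M) \<noteq> \<infinity>"
    by simp
  then have "AE \<omega> in M. Z \<omega> \<noteq> \<infinity>"
    by (intro nn_integral_noteq_infinite) measurable
  then show ?thesis
  proof (eventually_elim)
    fix \<omega> assume fin: "Z \<omega> \<noteq> \<infinity>"
    have "Y a b \<omega> \<le> enn2real (Z \<omega>) * l a b" for a b
    proof -
      have "ennreal (Y a b \<omega> / l a b) \<le> (\<Sum>b. ennreal (Y a b \<omega> / l a b))"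
        using sum_le_suminf[OF summableI, of "{b}" "\<lambda>b. ennreal (Y a b \<omega> / l a b)"] by simp
      also have "\<dots> \<le> Z \<omega>"
        using sum_le_suminf[OF summableI, of "{a}" "\<lambda>a. \<Sum>b. ennreal (Y a b \<omega> / l a b)"]
        by (simp add: Z_def)
      also have "\<dots> = ennreal (enn2real (Z \<omega>))"
        using fin by (simp add: less_top)
      finally have "Y a b \<omega> / l a b \<le> enn2real (Z \<omega>)"
        by (subst (asm) ennreal_le_iff) auto
      then show ?thesis
        using l[of a b] by (simp add: field_simps)
    qed
    then show "\<exists>K\<ge>0. \<forall>a b. Y a b \<omega> \<le> K * l a b"
      by (intro exI[of _ "enn2real (Z \<omega>)"]) auto
  qed
qed

section \<open>Harmonic sums over dyadic ranges\<close>

lemma sum_inverse_dyadic_le: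
  assumes "a \<le> b"
  shows "(\<Sum>n\<in>{2 ^ a<..2 ^ b :: nat}. 1 / real n) \<le> real (b - a)"
  using assms
proof (induction b rule: dec_induct)
  case base
  then show ?case by simp
next
  case (step b)
  have "{2 ^ a<..2 ^ Suc b :: nat} = {2 ^ a<..2 ^ b} \<union> {2 ^ b<..2 ^ Suc b}"
    using step.hyps by (intro ivl_disj_un_two(6)[symmetric]) simp_all
  then have "(\<Sum>n\<in>{2 ^ a<..2 ^ Suc b :: nat}. 1 / real n) =
      (\<Sum>n\<in>{2 ^ a<..2 ^ b :: nat}. 1 / real n) + (\<Sum>n\<in>{2 ^ b<..2 ^ Suc b :: nat}. 1 / real n)"
    by (simp add: sum.union_disjoint ivl_disj_int)
  \<comment> \<open>One doubling adds \<open>2 ^ b\<close> terms, each at most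
    \<open>1 / 2 ^ b\<close>.\<close>
  also have "(\<Sum>n\<in>{2 ^ b<..2 ^ Suc b :: nat}. 1 / real n) \<le> (\<Sum>n\<in>{2 ^ b<..2 ^ Suc b :: nat}. 1 / 2 ^ b)"
    by (intro sum_mono divide_left_mono) (auto intro: less_imp_le simp flip: of_nat_less_iff)
  also have "\<dots> = 1"
    by simp
  finally show ?case
    using step by (simp add: Suc_diff_le)
qed

lemma harm_power2_le: "(harm (2 ^ k) :: real) \<le> real k + 1"
proof -
  have "{1..2 ^ k :: nat} = insert 1 {2 ^ 0<..2 ^ k}"
    by auto
  then have "(harm (2 ^ k) :: real) = 1 + (\<Sum>n\<in>{2 ^ 0<..2 ^ k :: nat}. 1 / real n)"
    by (simp add: harm_def inverse_eq_divide)
  then show ?thesis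
    using sum_inverse_dyadic_le[of 0 k] by simp
qed

section \<open>Multiplicative energy of an interval\<close>

text \<open>For a finite set of positive integers this is the fourth moment of the unweighted
  Steinhaus sum over it.\<close>

definition mult_energy :: "nat set \<Rightarrow> nat" where
  "mult_energy A = card {((m, n), (a, b)). m \<in> A \<and> n \<in> A \<and> a \<in> A \<and> b \<in> A \<and> m * n = a * b}"

lemma card_multiples_interval_le:
  assumes "d > 0"
  shows "real (card {n \<in> {x<..x + y}. d dvd n}) \<le> real y / real d + 1"
proof -
  have "{n \<in> {x<..x + y}. d dvd n} \<subseteq> (\<lambda>q. d * q) ` {x div d<..(x + y) div d}"
  proof
    fix n assume "n \<in> {n \<in> {x<..x + y}. d dvd n}"
    then obtain q where q: "n = d * q" "x < d * q" "d * q \<le> x + y"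
      by auto
    have "x div d < q"
      using q(2) assms by (simp add: div_less_iff_less_mult mult.commute)
    moreover have "q \<le> (x + y) div d"
      using q(3) assms by (simp add: less_eq_div_iff_mult_less_eq mult.commute)
    ultimately show "n \<in> (\<lambda>q. d * q) ` {x div d<..(x + y) div d}"
      using q(1) by auto
  qed
  then have "card {n \<in> {x<..x + y}. d dvd n} \<le> card {x div d<..(x + y) div d}"
    by (meson card_image_le card_mono finite_greaterThanAtMost finite_imageI le_trans)
  also have "\<dots> = (x + y) div d - x div d"
    by simp
  \<comment> \<open>The last summand is the carry when the remainders of \<open>x\<close> and
    \<open>y\<close> are added; it is 0 or 1.\<close>
  also have "\<dots> = y div d + (x mod d + y mod d) div d"
    using div_add1_eq[of x y d] by simp
  also have "\<dots> \<le> y div d + 1"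
  proof -
    have "x mod d + y mod d < 2 * d"
      using mod_less_divisor[OF assms, of x] mod_less_divisor[OF assms, of y] by linarith
    then have "(x mod d + y mod d) div d < 2"
      using assms by (simp add: div_less_iff_less_mult)
    then show ?thesis
      by linarith
  qed
  finally have "real (card {n \<in> {x<..x + y}. d dvd n}) \<le> real (y div d + 1)"
    by (simp only: of_nat_le_iff)
  also have "\<dots> \<le> real y / real d + 1"
    using of_nat_div_le_of_nat[of y d, where 'a = real] by simp
  finally show ?thesis .
qed

text \<open>The gcd of two distinct members divides their difference, hence is at most
  \<open>y\<close>. Bounding it by the sum of all common divisors \<open>d \<le> y\<close> decouples
  \<open>m\<close> from \<open>a\<close>, and \<open>d\<close> has at most \<open>2 * y / d\<close>
  multiples in the interval. The diagonal must stay out, since \<open>gcd m m = m\<close> can far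
  exceed \<open>y\<close>.\<close>

lemma sum_gcd_offdiagonal_le:
  "(\<Sum>m\<in>{x<..x + y}. \<Sum>a\<in>{x<..x + y} - {m}. real (gcd m a)) \<le> 4 * real y ^ 2 * harm y"
proof -
  define I where "I = {x<..x + y}"
  define P where "P d m = (if d dvd m then 1 else 0 :: real)" for d m :: nat
  have gcd_le: "real (gcd m a) \<le> (\<Sum>d\<in>{1..y}. real d * (P d m * P d a))" if "m \<in> I" "a \<in> I" "m \<noteq> a" for m a
  proof -
    have "gcd m a dvd (if m < a then a - m else m - a)"
      by (simp add: dvd_diff_nat)
    then have "gcd m a \<le> (if m < a then a - m else m - a)"
      using that by (intro dvd_imp_le) (auto split: if_splits)
    also have "\<dots> \<le> y"
      using that by (auto simp: I_def)
    finally have "gcd m a \<in> {1..y}"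
      using that by (auto simp: I_def Suc_le_eq)
    then have "real (gcd m a) * (P (gcd m a) m * P (gcd m a) a) \<le> (\<Sum>d\<in>{1..y}. real d * (P d m * P d a))"
      by (intro member_le_sum) (auto simp: P_def)
    then show ?thesis
      by (simp add: P_def)
  qed
  have "(\<Sum>m\<in>I. \<Sum>a\<in>I - {m}. real (gcd m a)) \<le> (\<Sum>m\<in>I. \<Sum>a\<in>I - {m}. \<Sum>d\<in>{1..y}. real d * (P d m * P d a))"
    by (intro sum_mono gcd_le) auto
  \<comment> \<open>With \<open>d\<close> now confined to \<open>{1..y}\<close>, the diagonal can be
    put back at no real cost, and the double sum becomes a square.\<close>
  also have "\<dots> \<le> (\<Sum>m\<in>I. \<Sum>a\<in>I. \<Sum>d\<in>{1..y}. real d * (P d m * P d a))"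
    by (intro sum_mono sum_mono2) (auto intro!: sum_nonneg simp: I_def P_def)
  also have "\<dots> = (\<Sum>m\<in>I. \<Sum>d\<in>{1..y}. \<Sum>a\<in>I. real d * (P d m * P d a))"
    by (intro sum.cong refl sum.swap)
  also have "\<dots> = (\<Sum>d\<in>{1..y}. \<Sum>m\<in>I. \<Sum>a\<in>I. real d * (P d m * P d a))"
    by (rule sum.swap)
  also have "\<dots> = (\<Sum>d\<in>{1..y}. real d * (\<Sum>m\<in>I. P d m) ^ 2)"
    by (simp add: power2_eq_square sum_product sum_distrib_left[symmetric])
  also have "\<dots> \<le> (\<Sum>d\<in>{1..y}. 4 * real y ^ 2 * inverse (real d))"
  proof (rule sum_mono)
    fix d assume d: "d \<in> {1..y}"
    have "(\<Sum>m\<in>I. P d m) = real (card {n \<in> I. d dvd n})"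
      by (simp add: P_def I_def sum.If_cases Int_def)
    also have "\<dots> \<le> real y / real d + 1"
      unfolding I_def using d by (intro card_multiples_interval_le) auto
    \<comment> \<open>Since \<open>d \<le> y\<close>, the summand 1 is at most
      \<open>y / d\<close>.\<close>
    also have "\<dots> \<le> 2 * real y / real d"
      using d by (simp add: field_simps)
    finally have "(\<Sum>m\<in>I. P d m) ^ 2 \<le> (2 * real y / real d) ^ 2"
      by (intro power_mono sum_nonneg) (auto simp: P_def)
    then have "real d * (\<Sum>m\<in>I. P d m) ^ 2 \<le> real d * (2 * real y / real d) ^ 2"
      by (intro mult_left_mono) auto
    also have "\<dots> = 4 * real y ^ 2 * inverse (real d)"
      using d by (simp add: field_simps power2_eq_square)
    finally show "real d * (\<Sum>m\<in>I. P d m) ^ 2 \<le> 4 * real y ^ 2 * inverse (real d)" .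
  qed
  also have "\<dots> = 4 * real y ^ 2 * harm y"
    by (simp add: harm_def sum_distrib_left)
  finally show ?thesis
    by (simp add: I_def)
qed

text \<open>Given \<open>m\<close> and \<open>a\<close>, a solution of \<open>m * n = a * b\<close> is determined by \<open>n\<close>, which is a multiple of
  \<open>a div gcd m a\<close>.\<close>

lemma mult_energy_interval_le:
  assumes "N \<le> x" "y \<le> N" "y > 0"
  shows "real (mult_energy {x<..x + y}) \<le> 6 * real y ^ 2 * harm y"
proof -
  define I where "I = {x<..x + y}"
  have [simp]: "finite I" "card I = y"
    by (simp_all add: I_def)
  define D where "D m a = {n \<in> I. (a div gcd m a) dvd n}" for m a
  have "mult_energy I \<le> card (SIGMA m:I. SIGMA a:I. D m a)"
    unfolding mult_energy_def
  proof (rule card_inj_on_le)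
    show "inj_on (\<lambda>((m, n), (a, b)). (m, a, n))
        {((m, n), a, b). m \<in> I \<and> n \<in> I \<and> a \<in> I \<and> b \<in> I \<and> m * n = a * b}"
      by (auto simp: inj_on_def I_def)
    show "(\<lambda>((m, n), (a, b)). (m, a, n)) `
        {((m, n), a, b). m \<in> I \<and> n \<in> I \<and> a \<in> I \<and> b \<in> I \<and> m * n = a * b} \<subseteq> (SIGMA m:I. SIGMA a:I. D m a)"
    proof (clarsimp simp: D_def)
      fix m n a b assume "m \<in> I" "n \<in> I" "a \<in> I" "b \<in> I" "m * n = a * b"
      \<comment> \<open>Dividing both \<open>n * m\<close> and \<open>n * a\<close>,
        \<open>a\<close> divides \<open>n * gcd m a\<close>; the factor \<open>gcd m a\<close> is
        then cancelled.\<close>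
      then have "a dvd n * m" "a dvd n * a" "a > 0"
        by (auto simp: mult.commute I_def)
      then have "gcd m a * (a div gcd m a) dvd gcd m a * n"
        by (simp add: gcd_mult_distrib_nat mult.commute)
      then show "a div gcd m a dvd n"
        using \<open>a > 0\<close> by (subst (asm) nat_mult_dvd_cancel1) auto
    qed
    show "finite (SIGMA m:I. SIGMA a:I. D m a)"
      by (auto simp: D_def)
  qed
  also have "\<dots> = (\<Sum>m\<in>I. \<Sum>a\<in>I. card (D m a))"
    by (simp add: card_SigmaI D_def)
  finally have "real (mult_energy I) \<le> (\<Sum>m\<in>I. \<Sum>a\<in>I. real (card (D m a)))"
    by (simp flip: of_nat_sum)
  \<comment> \<open>On the diagonal the gcd is too large to be useful, so the trivial count
    \<open>y\<close> is used there.\<close>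
  also have "\<dots> = (\<Sum>m\<in>I. real (card (D m m)) + (\<Sum>a\<in>I - {m}. real (card (D m a))))"
    by (intro sum.cong refl sum.remove) auto
  also have "\<dots> \<le> (\<Sum>m\<in>I. real y + (\<Sum>a\<in>I - {m}. real (gcd m a) + 1))"
  proof (intro sum_mono add_mono)
    fix m assume "m \<in> I"
    have "card (D m m) \<le> card I"
      by (intro card_mono) (auto simp: D_def)
    then show "real (card (D m m)) \<le> real y"
      by simp
  next
    fix m a assume m: "m \<in> I" and "a \<in> I - {m}"
    then have a: "a \<in> I" "a > 0" "N \<le> a"
      using assms by (auto simp: I_def)
    have "real (card (D m a)) \<le> real y / real (a div gcd m a) + 1"
      unfolding D_def I_def using a by (intro card_multiples_interval_le) (auto simp: dvd_imp_le div_greater_zero_iff)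
    \<comment> \<open>The quotient \<open>y / a\<close> is at most 1 because
      \<open>y \<le> N \<le> a\<close>: the interval is no longer than its distance from 0.\<close>
    also have "real y / real (a div gcd m a) = real y / real a * real (gcd m a)"
      by (simp add: real_of_nat_div)
    also have "\<dots> \<le> 1 * real (gcd m a)"
      using a assms by (intro mult_right_mono) auto
    finally show "real (card (D m a)) \<le> real (gcd m a) + 1"
      by simp
  qed
  also have "\<dots> \<le> (\<Sum>m\<in>I. 2 * real y + (\<Sum>a\<in>I - {m}. real (gcd m a)))"
    using assms(3) by (intro sum_mono) (simp add: sum.distrib)
  also have "\<dots> \<le> 2 * real y ^ 2 * 1 + 4 * real y ^ 2 * harm y"
    using sum_gcd_offdiagonal_le[where x = x and y = y]
    by (simp add: sum.distrib I_def power2_eq_square)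
  also have "\<dots> \<le> 2 * real y ^ 2 * harm y + 4 * real y ^ 2 * harm y"
  proof (intro add_mono mult_left_mono order.refl)
    have "(harm 1 :: real) \<le> harm y"
      using assms(3) by (intro harm_mono) auto
    then show "1 \<le> (harm y :: real)"
      by (simp add: harm_expand)
  qed auto
  finally show ?thesis
    by (simp add: I_def mult_ac)
qed

section \<open>Moments of Steinhaus sums\<close>

text \<open>Allows products for different integers to be taken over one common set of primes; the
  additional primes have exponent 0.\<close>

lemma multiplicative_extension_eq_prod:
  assumes "finite P" "prime_factors n \<subseteq> P" "\<And>p. p \<in> P \<Longrightarrow> prime p"
  shows "multiplicative_extension f n = (\<Prod>p\<in>P. f p ^ multiplicity p n)"
  unfolding multiplicative_extension_def
proof (rule prod.mono_neutral_left)
  show "\<forall>p\<in>P - prime_factors n. f p ^ multiplicity p n = 1"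
    using assms(3) by (auto simp: prime_factors_multiplicity)
qed (use assms in auto)

lemma multiplicative_extension_mult:
  assumes "m > 0" "n > 0"
  shows "multiplicative_extension f (m * n) = multiplicative_extension f m * multiplicative_extension f n"
proof -
  define P where "P = prime_factors (m * n)"
  have P: "finite P" "prime_factors m \<subseteq> P" "prime_factors n \<subseteq> P" "\<And>p. p \<in> P \<Longrightarrow> prime p"
    using assms by (auto simp: P_def prime_factors_product)
  have "multiplicity p (m * n) = multiplicity p m + multiplicity p n" if "p \<in> P" for p
    using P(4)[OF that] assms by (intro prime_elem_multiplicity_mult_distrib) auto
  then have "multiplicative_extension f (m * n) = (\<Prod>p\<in>P. f p ^ multiplicity p m * f p ^ multiplicity p n)"
    using P by (subst multiplicative_extension_eq_prod[of P])
      (auto simp: P_def power_add intro!: prod.cong)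
  also have "\<dots> = multiplicative_extension f m * multiplicative_extension f n"
    using P by (simp add: multiplicative_extension_eq_prod[of P] prod.distrib)
  finally show ?thesis .
qed

text \<open>On the circle the integrand is the character with frequency \<open>k = m - n\<close>,
  whose mean over a full period vanishes unless \<open>k = 0\<close>.\<close>

lemma uniform_circle_orthogonal:
  "(\<integral>z. z ^ m * cnj z ^ n \<partial>uniform_circle) = of_bool (m = n)"
proof -
  define k where "k = int m - int n"
  have [measurable]: "cnj \<in> borel_measurable borel"
    by (intro borel_measurable_continuous_onI continuous_intros)
  have "(\<integral>z. z ^ m * cnj z ^ n \<partial>uniform_circle) =
      (\<integral>t. cis t ^ m * cnj (cis t) ^ n \<partial>uniform_measure lborel {0..2 * pi})"
    unfolding uniform_circle_def by (intro integral_distr cis_borel_measurable) measurable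
  also have "\<dots> = (\<integral>t. cis (of_int k * t) \<partial>uniform_measure lborel {0..2 * pi})"
  proof (intro Bochner_Integration.integral_cong refl)
    fix t :: real
    show "cis t ^ m * cnj (cis t) ^ n = cis (of_int k * t)"
      unfolding cis_cnj Complex.DeMoivre cis_mult by (simp add: k_def algebra_simps)
  qed
  also have "\<dots> = (\<integral>t. indicator {0..2 * pi} t *\<^sub>R (cis (of_int k * t) / complex_of_real (2 * pi)) \<partial>lborel)"
  proof -
    have "uniform_measure lborel {0..2 * pi} = density lborel (\<lambda>t. ennreal (indicator {0..2 * pi} t / (2 * pi)))"
      unfolding uniform_measure_def
      by (intro arg_cong2[where f = density] refl ext) (auto simp: divide_ennreal[symmetric] split: split_indicator)
    moreover have "(\<lambda>t. cis (of_int k * t)) \<in> borel_measurable lborel"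
      by (simp, intro borel_measurable_continuous_onI continuous_intros)
    ultimately show ?thesis
      by (simp add: integral_density scaleR_conv_of_real)
  qed
  also have "\<dots> = of_bool (k = 0)"
  proof (cases "k = 0")
    case True
    then show ?thesis
      by (simp add: scaleR_conv_of_real)
  next
    case False
    \<comment> \<open>An explicit antiderivative; by periodicity it takes the same value at 0 and
      \<open>2 * pi\<close>.\<close>
    have "((\<lambda>t. cis (of_int k * t) / (\<i> * of_int k * of_real (2 * pi))) has_vector_derivative
        cis (of_int k * t) / of_real (2 * pi)) (at t within {0..2 * pi})" for t
      unfolding has_vector_derivative_def using False
      by (auto intro!: derivative_eq_intros simp: scaleR_conv_of_real field_simps)
    then have "(\<integral>t. indicator {0..2 * pi} t *\<^sub>R (cis (of_int k * t) / complex_of_real (2 * pi)) \<partial>lborel) =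
        cis (of_int k * (2 * pi)) / (\<i> * of_int k * of_real (2 * pi)) - cis (of_int k * 0) / (\<i> * of_int k * of_real (2 * pi))"
      by (intro integral_FTC_atLeastAtMost) (auto intro!: continuous_intros)
    also have "cis (of_int k * (2 * pi)) = 1"
      using cis_multiple_2pi[of "of_int k"] by (simp add: mult_ac)
    finally show ?thesis
      using False by simp
  qed
  also have "of_bool (k = 0) = of_bool (m = n)"
    by (simp add: k_def)
  finally show ?thesis .
qed

section \<open>The Steinhaus model: orthogonality, second and fourth moments\<close>

locale steinhaus = prob_space M for M :: "'a measure" +
  fixes X :: "nat \<Rightarrow> 'a \<Rightarrow> complex"
  assumes indep: "indep_vars (\<lambda>_. borel) X {p. prime p}"
    and distr: "\<And>p. prime p \<Longrightarrow> distr M borel (X p) = uniform_circle"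
begin

definition F :: "nat \<Rightarrow> 'a \<Rightarrow> complex" where
  "F n \<omega> = multiplicative_extension (\<lambda>p. X p \<omega>) n"

lemma X_measurable: "prime p \<Longrightarrow> X p \<in> borel_measurable M"
  using indep by (auto simp: indep_vars_def2)

lemma F_measurable [measurable]: "F n \<in> borel_measurable M"
  unfolding F_def multiplicative_extension_def
  by (intro borel_measurable_prod borel_measurable_power X_measurable) auto

text \<open>Over the primes dividing \<open>m\<close> or \<open>n\<close> the product splits into
  independent factors, each a character of a single \<open>X p\<close>. The expectation is nonzero
  only if all exponents agree, which by unique factorization means \<open>m = n\<close>.\<close>

lemma
  assumes "m > 0" "n > 0"
  shows F_mult_cnj_integrable: "integrable M (\<lambda>\<omega>. F m \<omega> * cnj (F n \<omega>))"
    and F_orthogonal: "(\<integral>\<omega>. F m \<omega> * cnj (F n \<omega>) \<partial>M) = of_bool (m = n)"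
proof -
  define P where "P = prime_factors m \<union> prime_factors n"
  have P: "finite P" "prime_factors m \<subseteq> P" "prime_factors n \<subseteq> P" "\<And>p. p \<in> P \<Longrightarrow> prime p"
    by (auto simp: P_def)
  define G where "G p z = z ^ multiplicity p m * cnj z ^ multiplicity p n" for p and z :: complex
  have [measurable]: "cnj \<in> borel_measurable borel"
    by (intro borel_measurable_continuous_onI continuous_intros)
  have G [measurable]: "G p \<in> borel_measurable borel" for p
    unfolding G_def by measurable
  have FG: "F m \<omega> * cnj (F n \<omega>) = (\<Prod>p\<in>P. G p (X p \<omega>))" for \<omega>
    using P by (simp add: F_def G_def multiplicative_extension_eq_prod[of P] prod.distrib)
  have indep': "indep_vars (\<lambda>_. borel) (\<lambda>p \<omega>. G p (X p \<omega>)) P"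
    by (rule indep_vars_compose2[OF indep_vars_subset[OF indep] G]) (use P in auto)
  have int: "integrable M (\<lambda>\<omega>. G p (X p \<omega>))" if "p \<in> P" for p
  proof -
    \<comment> \<open>The law lives on the whole plane, so modulus 1 is only an almost sure fact;
      this suffices for integrability.\<close>
    have "AE z in distr M borel (X p). norm z = 1"
      unfolding distr[OF P(4)[OF that]] by (rule AE_uniform_circle)
    then have "AE \<omega> in M. norm (X p \<omega>) = 1"
      by (rule AE_distrD[OF X_measurable[OF P(4)[OF that]]])
    then show ?thesis
      using X_measurable[of p] P(4)[OF that]
      by (intro integrable_const_bound[where B = 1]) (auto simp: G_def norm_mult norm_power)
  qed
  show "integrable M (\<lambda>\<omega>. F m \<omega> * cnj (F n \<omega>))"
    unfolding FG using P indep' int by (intro indep_vars_integrable)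
  have "(\<integral>\<omega>. F m \<omega> * cnj (F n \<omega>) \<partial>M) = (\<Prod>p\<in>P. \<integral>\<omega>. G p (X p \<omega>) \<partial>M)"
    unfolding FG using P indep' int by (intro indep_vars_lebesgue_integral)
  also have "\<dots> = (\<Prod>p\<in>P. of_bool (multiplicity p m = multiplicity p n))"
  proof (intro prod.cong refl)
    fix p assume "p \<in> P"
    then have "prime p"
      by (rule P(4))
    then have "(\<integral>\<omega>. G p (X p \<omega>) \<partial>M) = (\<integral>z. G p z \<partial>distr M borel (X p))"
      by (intro integral_distr[symmetric] X_measurable G)
    also have "\<dots> = of_bool (multiplicity p m = multiplicity p n)"
      unfolding G_def by (simp only: distr[OF \<open>prime p\<close>] uniform_circle_orthogonal)
    finally show "(\<integral>\<omega>. G p (X p \<omega>) \<partial>M) = of_bool (multiplicity p m = multiplicity p n)" .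
  qed
  also have "\<dots> = of_bool (m = n)"
  proof (cases "m = n")
    case False
    then obtain p where p: "prime p" "multiplicity p m \<noteq> multiplicity p n"
      using multiplicity_eq_nat[of m n] assms by auto
    then have "p \<in> P"
      by (auto simp: P_def prime_factors_multiplicity)
    then show ?thesis
      using p False P(1) by (auto simp: prod_zero_iff)
  qed simp
  finally show "(\<integral>\<omega>. F m \<omega> * cnj (F n \<omega>) \<partial>M) = of_bool (m = n)" .
qed

text \<open>Parseval's identity for the orthonormal family \<open>F n\<close>: expand the square,
  and only the diagonal survives.\<close>

lemma second_moment:
  fixes c :: "nat \<Rightarrow> complex"
  assumes "finite A" "0 \<notin> A"
  shows "(\<integral>\<^sup>+\<omega>. ennreal (norm (\<Sum>n\<in>A. c n * F n \<omega>) ^ 2) \<partial>M) = ennreal (\<Sum>n\<in>A. norm (c n) ^ 2)"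
proof -
  let ?S = "\<lambda>\<omega>. \<Sum>n\<in>A. c n * F n \<omega>"
  have pos: "n > 0" if "n \<in> A" for n
    using assms that by (cases n) auto
  have eq: "complex_of_real (norm (?S \<omega>) ^ 2) = (\<Sum>m\<in>A. \<Sum>n\<in>A. c m * cnj (c n) * (F m \<omega> * cnj (F n \<omega>)))" for \<omega>
    by (simp add: complex_norm_square sum_product mult_ac del: of_real_power)
  have int: "integrable M (\<lambda>\<omega>. complex_of_real (norm (?S \<omega>) ^ 2))"
    unfolding eq by (intro Bochner_Integration.integrable_sum integrable_mult_right F_mult_cnj_integrable pos)
  have "complex_of_real (\<integral>\<omega>. norm (?S \<omega>) ^ 2 \<partial>M) = (\<integral>\<omega>. complex_of_real (norm (?S \<omega>) ^ 2) \<partial>M)"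
    by (rule integral_complex_of_real[symmetric])
  also have "\<dots> = (\<Sum>m\<in>A. \<Sum>n\<in>A. c m * cnj (c n) * of_bool (m = n))"
    unfolding eq using pos
    by (simp add: Bochner_Integration.integral_sum F_mult_cnj_integrable F_orthogonal cong: sum.cong)
  also have "\<dots> = complex_of_real (\<Sum>n\<in>A. norm (c n) ^ 2)"
    using assms(1) by (simp add: complex_norm_square of_bool_def if_distrib sum.delta' cong: if_cong del: of_real_power)
  finally have "(\<integral>\<omega>. norm (?S \<omega>) ^ 2 \<partial>M) = (\<Sum>n\<in>A. norm (c n) ^ 2)"
    by (simp only: of_real_eq_iff)
  moreover have "integrable M (\<lambda>\<omega>. norm (?S \<omega>) ^ 2)"
    using int by (simp only: complex_of_real_integrable_eq)
  ultimately show ?thesis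
    by (subst nn_integral_eq_integral) auto
qed

text \<open>By complete multiplicativity the square of the sum is again a linear form in the
  \<open>F k\<close>, so its second moment is known. The squared numbers of representations
  \<open>k = m * n\<close> add up to the energy, and each weight \<open>1 / k\<close> is at most
  \<open>1 / N ^ 2\<close> because both factors exceed \<open>N\<close>.\<close>

lemma fourth_moment:
  assumes "finite A" "A \<subseteq> {N<..}" "N > 0"
  shows "(\<integral>\<^sup>+\<omega>. ennreal (norm (\<Sum>n\<in>A. F n \<omega> / complex_of_real (sqrt (real n))) ^ 4) \<partial>M)
    \<le> ennreal (real (mult_energy A) / real N ^ 2)"
proof -
  define R where "R k = {p \<in> A \<times> A. fst p * snd p = k}" for k
  define K where "K = (\<lambda>p. fst p * snd p) ` (A \<times> A)"
  define d where "d k = complex_of_real (real (card (R k)) / sqrt (real k))" for k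
  have [simp]: "finite K" "finite (R k)" for k
    using assms(1) by (simp_all add: K_def R_def)
  have pos: "n > 0" if "n \<in> A" for n
    using assms that by fastforce
  have K0: "0 \<notin> K"
    using pos[of 0] by (auto simp: K_def)
  have sq: "(\<Sum>n\<in>A. F n \<omega> / complex_of_real (sqrt (real n))) ^ 2 = (\<Sum>k\<in>K. d k * F k \<omega>)" for \<omega>
  proof -
    have "(\<Sum>n\<in>A. F n \<omega> / complex_of_real (sqrt (real n))) ^ 2 =
        (\<Sum>p\<in>A \<times> A. F (fst p * snd p) \<omega> / complex_of_real (sqrt (real (fst p * snd p))))"
      by (auto simp: power2_eq_square sum_product sum.cartesian_product F_def real_sqrt_mult
          multiplicative_extension_mult pos intro!: sum.cong)
    also have "\<dots> = (\<Sum>k\<in>K. \<Sum>p\<in>R k. F (fst p * snd p) \<omega> / complex_of_real (sqrt (real (fst p * snd p))))"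
      unfolding K_def R_def using assms(1) by (intro sum.image_gen) auto
    also have "\<dots> = (\<Sum>k\<in>K. \<Sum>p\<in>R k. F k \<omega> / complex_of_real (sqrt (real k)))"
      by (intro sum.cong refl) (simp add: R_def)
    also have "\<dots> = (\<Sum>k\<in>K. d k * F k \<omega>)"
      by (simp add: d_def)
    finally show ?thesis .
  qed
  have "(\<integral>\<^sup>+\<omega>. ennreal (norm (\<Sum>n\<in>A. F n \<omega> / complex_of_real (sqrt (real n))) ^ 4) \<partial>M) =
      (\<integral>\<^sup>+\<omega>. ennreal (norm (\<Sum>k\<in>K. d k * F k \<omega>) ^ 2) \<partial>M)"
    by (simp flip: sq add: norm_power power_mult[symmetric])
  also have "\<dots> = ennreal (\<Sum>k\<in>K. norm (d k) ^ 2)"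
    using K0 by (intro second_moment) auto
  also have "(\<Sum>k\<in>K. norm (d k) ^ 2) \<le> (\<Sum>k\<in>K. real (card (R k)) ^ 2 / real N ^ 2)"
  proof (intro sum_mono)
    fix k assume "k \<in> K"
    then obtain m n where mn: "m \<in> A" "n \<in> A" "k = m * n"
      by (auto simp: K_def)
    then have "N ^ 2 \<le> k"
      using assms(2) by (auto simp: power2_eq_square intro!: mult_mono)
    then have "real N ^ 2 \<le> real k"
      by (metis of_nat_le_iff of_nat_power)
    moreover have "k > 0"
      using K0 \<open>k \<in> K\<close> by (cases k) auto
    ultimately show "norm (d k) ^ 2 \<le> real (card (R k)) ^ 2 / real N ^ 2"
      using assms(3) by (auto simp: d_def norm_divide power_divide intro!: divide_left_mono mult_pos_pos)
  qed
  also have "\<dots> = real (\<Sum>k\<in>K. card (R k \<times> R k)) / real N ^ 2"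
    by (simp add: sum_divide_distrib[symmetric] power2_eq_square card_cartesian_product)
  \<comment> \<open>Two representations of the same \<open>k\<close> are a solution of
    \<open>m * n = a * b\<close>, and different \<open>k\<close> give disjoint sets of
    solutions.\<close>
  also have "(\<Sum>k\<in>K. card (R k \<times> R k)) = card (\<Union>k\<in>K. R k \<times> R k)"
  proof (intro card_UN_disjoint[symmetric] ballI impI)
    show "finite (R k \<times> R k)" for k
      by simp
  qed (auto simp: R_def)
  also have "(\<Union>k\<in>K. R k \<times> R k) = {((m, n), (a, b)). m \<in> A \<and> n \<in> A \<and> a \<in> A \<and> b \<in> A \<and> m * n = a * b}"
    unfolding R_def K_def by (simp add: set_eq_iff) metis
  finally show ?thesis
    by (simp add: mult_energy_def ennreal_leI)
qed

end

section \<open>Almost sure bounds for the partial sums\<close>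

lemma sum_geometric_le:
  fixes q :: real
  assumes "0 \<le> q" "q < 1"
  shows "(\<Sum>k<r. q ^ k) \<le> 1 / (1 - q)"
proof -
  have "(\<Sum>k<r. q ^ k) \<le> (\<Sum>k. q ^ k)"
    using assms by (intro sum_le_suminf summable_geometric) auto
  also have "\<dots> = 1 / (1 - q)"
    using assms by (intro suminf_geometric) auto
  finally show ?thesis .
qed

lemma summable_Suc_powr:
  assumes "s < -1"
  shows "summable (\<lambda>n. (real n + 1) powr s)"
proof -
  have "summable (\<lambda>n. real (Suc n) powr s)"
    using assms by (subst summable_Suc_iff) (simp add: summable_real_powr_iff)
  then show ?thesis
    by (simp add: add.commute)
qed

section \<open>Integer partial sums: moments of increments and almost sure bounds\<close>

context steinhaus
begin

definition S :: "nat \<Rightarrow> 'a \<Rightarrow> complex" where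
  "S n \<omega> = (\<Sum>k\<in>{1..n}. F k \<omega> / complex_of_real (sqrt (real k)))"

lemma S_measurable [measurable]: "S n \<in> borel_measurable M"
  unfolding S_def by measurable

lemma S_diff:
  assumes "a \<le> b"
  shows "S b \<omega> - S a \<omega> = (\<Sum>n\<in>{a<..b}. F n \<omega> / complex_of_real (sqrt (real n)))"
proof -
  have "{1..b} = {1..a} \<union> {a<..b}"
    using assms by auto
  then have "S b \<omega> = S a \<omega> + (\<Sum>n\<in>{a<..b}. F n \<omega> / complex_of_real (sqrt (real n)))"
    unfolding S_def by (simp add: sum.union_disjoint ivl_disj_int)
  then show ?thesis
    by simp
qed

text \<open>In terms of the exponent, the sums at powers of two behave like a process with
  orthogonal increments and at most unit variance per step.\<close>

lemma S_dyadic_second_moment: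
  assumes "a \<le> b"
  shows "(\<integral>\<^sup>+\<omega>. ennreal (norm (S (2 ^ b) \<omega> - S (2 ^ a) \<omega>) ^ 2) \<partial>M) \<le> ennreal (real (b - a))"
proof -
  have "(\<integral>\<^sup>+\<omega>. ennreal (norm (S (2 ^ b) \<omega> - S (2 ^ a) \<omega>) ^ 2) \<partial>M) =
      (\<integral>\<^sup>+\<omega>. ennreal (norm (\<Sum>n\<in>{2 ^ a<..2 ^ b}. 1 / complex_of_real (sqrt (real n)) * F n \<omega>) ^ 2) \<partial>M)"
    using assms by (simp add: S_diff)
  also have "\<dots> = ennreal (\<Sum>n\<in>{2 ^ a<..2 ^ b}. norm (1 / complex_of_real (sqrt (real n))) ^ 2)"
    by (intro second_moment) auto
  also have "(\<Sum>n\<in>{2 ^ a<..2 ^ b :: nat}. norm (1 / complex_of_real (sqrt (real n))) ^ 2) =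
      (\<Sum>n\<in>{2 ^ a<..2 ^ b :: nat}. 1 / real n)"
    by (simp add: norm_divide power_divide)
  also have "\<dots> \<le> real (b - a)"
    by (intro sum_inverse_dyadic_le assms)
  finally show ?thesis
    by (simp add: ennreal_leI)
qed

text \<open>The interval lies beyond \<open>2 ^ j\<close> and has length
  \<open>2 ^ k \<le> 2 ^ j\<close>, so the energy bound applies with \<open>N = 2 ^ j\<close>; the
  harmonic number contributes the factor \<open>j + 1\<close>.\<close>

lemma S_block_fourth_moment:
  assumes "k \<le> j"
  shows "(\<integral>\<^sup>+\<omega>. ennreal (norm (S (2 ^ j + (i + 1) * 2 ^ k) \<omega> - S (2 ^ j + i * 2 ^ k) \<omega>) ^ 4) \<partial>M)
    \<le> ennreal (6 * (real j + 1) * (1 / 4) ^ (j - k))"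
proof -
  define x where "x = 2 ^ j + i * 2 ^ k"
  have "(\<integral>\<^sup>+\<omega>. ennreal (norm (S (2 ^ j + (i + 1) * 2 ^ k) \<omega> - S (2 ^ j + i * 2 ^ k) \<omega>) ^ 4) \<partial>M) =
      (\<integral>\<^sup>+\<omega>. ennreal (norm (\<Sum>n\<in>{x<..x + 2 ^ k}. F n \<omega> / complex_of_real (sqrt (real n))) ^ 4) \<partial>M)"
    by (simp add: S_diff[symmetric] x_def algebra_simps)
  also have "\<dots> \<le> ennreal (real (mult_energy {x<..x + 2 ^ k}) / real (2 ^ j) ^ 2)"
    by (intro fourth_moment) (auto simp: x_def)
  also have "real (mult_energy {x<..x + 2 ^ k}) / real (2 ^ j) ^ 2 \<le>
      (6 * real (2 ^ k) ^ 2 * (real j + 1)) / real (2 ^ j) ^ 2"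
  proof (rule divide_right_mono)
    have "real (mult_energy {x<..x + 2 ^ k}) \<le> 6 * real (2 ^ k) ^ 2 * harm (2 ^ k)"
      using assms by (intro mult_energy_interval_le[where N = "2 ^ j"]) (auto simp: x_def)
    also have "\<dots> \<le> 6 * real (2 ^ k) ^ 2 * (real j + 1)"
      using harm_power2_le[of k] assms by (intro mult_left_mono) auto
    finally show "real (mult_energy {x<..x + 2 ^ k}) \<le> 6 * real (2 ^ k) ^ 2 * (real j + 1)" .
  qed simp
  also have "\<dots> = 6 * (real j + 1) * ((real (2 ^ k) ^ 2) / real (2 ^ j) ^ 2)"
    by simp
  also have "(real (2 ^ k) ^ 2) / real (2 ^ j) ^ 2 = (1 / 4) ^ (j - k)"
  proof -
    have "(2::real) ^ j = 2 ^ k * 2 ^ (j - k)"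
      using assms by (simp flip: power_add)
    then have "(real (2 ^ k) ^ 2) / real (2 ^ j) ^ 2 = 1 / (2 ^ (j - k)) ^ 2"
      by (simp add: power_mult_distrib)
    also have "\<dots> = (1 / 4) ^ (j - k)"
      by (simp add: power_divide power_mult[symmetric] mult.commute[of _ 2] power_mult)
    finally show ?thesis .
  qed
  finally show ?thesis
    by (simp add: ennreal_leI)
qed

text \<open>An increment over \<open>2 ^ k\<close> exponents has second moment at most
  \<open>2 ^ k\<close>. The allowance \<open>l\<close> exceeds this by a small power of the right
  end \<open>(i + 1) * 2 ^ k\<close>, enough to sum over all dyadic intervals and to make the
  chaining sum geometric.\<close>

lemma AE_dyadic_points:
  assumes \<epsilon>: "\<epsilon> > 0"
  shows "AE \<omega> in M. \<exists>K\<ge>0. \<forall>t. norm (S (2 ^ t) \<omega> - S 1 \<omega>) \<le> K * real t powr (1 / 2 + \<epsilon>)"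
proof -
  \<comment> \<open>Chosen with \<open>q ^ 4 = 2 powr (- 2 * \<epsilon>)\<close>: the surplus
    \<open>2 powr (2 * \<epsilon> * k)\<close> pays for two factors \<open>q ^ (2 * k)\<close>, one
    for summability over \<open>k\<close> and one kept in \<open>l\<close> as decay along the
    chain.\<close>
  define q :: real where "q = 2 powr (- \<epsilon> / 2)"
  have q: "0 < q" "q < 1"
    using \<epsilon> by (auto simp: q_def powr_less_one)
  define D where "D k i \<omega> = norm (S (2 ^ ((i + 1) * 2 ^ k)) \<omega> - S (2 ^ (i * 2 ^ k)) \<omega>)" for k i \<omega>
  define l where "l k i = ((real i + 1) * 2 ^ k) powr (1 + 2 * \<epsilon>) * (q ^ k) ^ 2" for k i
  have "AE \<omega> in M. \<exists>K\<ge>0. \<forall>k i. D k i \<omega> ^ 2 \<le> K * l k i"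
  proof (rule AE_weighted_bound)
    show "(\<lambda>\<omega>. D k i \<omega> ^ 2) \<in> borel_measurable M" for k i
      unfolding D_def by measurable
    show "l k i > 0" for k i
      using q by (simp add: l_def)
    show "summable (\<lambda>k. (q ^ 2) ^ k)"
      using q by (intro summable_geometric) (simp add: power_less_one_iff)
    show "summable (\<lambda>i. (real i + 1) powr (- (1 + 2 * \<epsilon>)))"
      using \<epsilon> by (intro summable_Suc_powr) simp
    fix k i :: nat
    have q_powr: "(q ^ 2) ^ k * (q ^ k) ^ 2 = (2 ^ k) powr (- 2 * \<epsilon>)"
      by (simp add: q_def powr_powr powr_realpow[symmetric] powr_add[symmetric] algebra_simps)
    have "(q ^ 2) ^ k * (real i + 1) powr (- (1 + 2 * \<epsilon>)) * l k i =
        ((q ^ 2) ^ k * (q ^ k) ^ 2) * (2 ^ k) powr (1 + 2 * \<epsilon>) *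
        ((real i + 1) powr (- (1 + 2 * \<epsilon>)) * (real i + 1) powr (1 + 2 * \<epsilon>))"
      by (simp add: l_def powr_mult add.commute)
    also have "(real i + 1) powr (- (1 + 2 * \<epsilon>)) * (real i + 1) powr (1 + 2 * \<epsilon>) = 1"
      unfolding powr_add[symmetric] by simp
    also have "((q ^ 2) ^ k * (q ^ k) ^ 2) * (2 ^ k) powr (1 + 2 * \<epsilon>) = 2 ^ k"
      unfolding q_powr powr_add[symmetric] by simp
    finally have "(q ^ 2) ^ k * (real i + 1) powr (- (1 + 2 * \<epsilon>)) * l k i = 2 ^ k"
      by simp
    then show "(\<integral>\<^sup>+\<omega>. ennreal (D k i \<omega> ^ 2) \<partial>M) \<le>
        ennreal ((q ^ 2) ^ k * (real i + 1) powr (- (1 + 2 * \<epsilon>)) * l k i)"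
      using S_dyadic_second_moment[of "i * 2 ^ k" "(i + 1) * 2 ^ k"] by (simp add: D_def)
  qed auto
  then show ?thesis
  proof eventually_elim
    case (elim \<omega>)
    then obtain K where K: "K \<ge> 0" "\<And>k i. D k i \<omega> ^ 2 \<le> K * l k i"
      by auto
    have "norm (S (2 ^ t) \<omega> - S 1 \<omega>) \<le> ((K + 1) / (1 - q)) * real t powr (1 / 2 + \<epsilon>)" for t
    proof -
      \<comment> \<open>Using \<open>K + 1\<close> avoids a root:
        \<open>K \<le> (K + 1) ^ 2\<close>.\<close>
      define C where "C = (K + 1) * real t powr (1 / 2 + \<epsilon>)"
      have C: "C \<ge> 0"
        using K by (simp add: C_def)
      have C2: "C ^ 2 = (K + 1) ^ 2 * real t powr (1 + 2 * \<epsilon>)"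
      proof -
        have "(real t powr (1 / 2 + \<epsilon>)) ^ 2 = real t powr ((1 / 2 + \<epsilon>) + (1 / 2 + \<epsilon>))"
          by (simp only: power2_eq_square powr_add)
        also have "(1 / 2 + \<epsilon>) + (1 / 2 + \<epsilon>) = 1 + 2 * \<epsilon>"
          by simp
        finally show ?thesis
          by (simp only: C_def power_mult_distrib)
      qed
      \<comment> \<open>As \<open>t < 2 ^ t\<close>, \<open>t\<close> levels suffice; having more
        levels than digits is harmless because the bounds form a geometric series.\<close>
      have "norm (S (2 ^ t) \<omega> - S (2 ^ 0) \<omega>) \<le> (\<Sum>k<t. C * q ^ k)"
      proof (rule dyadic_chaining[where S = "\<lambda>u. S (2 ^ u) \<omega>"])
        fix k i assume le: "(i + 1) * 2 ^ k \<le> t"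
        have "D k i \<omega> ^ 2 \<le> K * l k i"
          by (rule K(2))
        also have "\<dots> \<le> (K + 1) ^ 2 * (real t powr (1 + 2 * \<epsilon>) * (q ^ k) ^ 2)"
          unfolding l_def
        proof (intro mult_mono powr_mono2)
          show "K \<le> (K + 1) ^ 2"
            using K by (simp add: power2_eq_square algebra_simps add_increasing)
          have "real ((i + 1) * 2 ^ k) \<le> real t"
            using le by (simp only: of_nat_le_iff)
          then show "(real i + 1) * 2 ^ k \<le> real t"
            by (simp add: distrib_right)
        qed (use K \<epsilon> in auto)
        also have "\<dots> = (C * q ^ k) ^ 2"
          by (simp only: power_mult_distrib C2 mult.assoc)
        finally have "D k i \<omega> ^ 2 \<le> (C * q ^ k) ^ 2" .
        then have "D k i \<omega> \<le> C * q ^ k"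
          by (rule power2_le_imp_le) (use C q in simp)
        then show "norm (S (2 ^ ((i + 1) * 2 ^ k)) \<omega> - S (2 ^ (i * 2 ^ k)) \<omega>) \<le> C * q ^ k"
          unfolding D_def .
      qed (use C q less_exp in simp_all)
      also have "\<dots> \<le> C * (1 / (1 - q))"
        unfolding sum_distrib_left[symmetric] using C q by (intro mult_left_mono sum_geometric_le) auto
      finally show ?thesis
        by (simp add: C_def)
    qed
    moreover have "(K + 1) / (1 - q) \<ge> 0"
      using K q by simp
    ultimately show ?case
      by blast
  qed
qed

text \<open>At depth \<open>r = j - k\<close> the sum of the fourth powers of all
  \<open>2 ^ r\<close> increments dominates their maximum, and its expectation is at most
  \<open>6 * (j + 1) / 2 ^ r\<close>. Divided by \<open>l\<close>, this is still summable over both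
  \<open>j\<close> and \<open>r\<close>.\<close>

lemma AE_dyadic_blocks:
  assumes \<epsilon>: "\<epsilon> > 0"
  shows "AE \<omega> in M. \<exists>K\<ge>0. \<forall>j. \<forall>u<2 ^ j.
    norm (S (2 ^ j + u) \<omega> - S (2 ^ j) \<omega>) \<le> K * (real j + 1) powr (1 / 2 + \<epsilon>)"
proof -
  \<comment> \<open>any ratio with \<open>1 / 2 < q ^ 4\<close> and \<open>q < 1\<close> would do\<close>
  define q :: real where "q = 9 / 10"
  define D where "D j k i \<omega> = norm (S (2 ^ j + (i + 1) * 2 ^ k) \<omega> - S (2 ^ j + i * 2 ^ k) \<omega>)" for j k i \<omega>
  \<comment> \<open>Levels are counted by depth, as the decay is in \<open>r\<close>; the value 0
    for \<open>r > j\<close> merely fills up the double family.\<close>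
  define Y where "Y j r \<omega> = (if r \<le> j then \<Sum>i<2 ^ r. D j (j - r) i \<omega> ^ 4 else 0)" for j r \<omega>
  define l where "l j r = (real j + 1) powr (2 + 4 * \<epsilon>) * (q ^ r) ^ 4" for j r :: nat
  have "AE \<omega> in M. \<exists>K\<ge>0. \<forall>j r. Y j r \<omega> \<le> K * l j r"
  proof (rule AE_weighted_bound)
    have [measurable]: "D j k i \<in> borel_measurable M" for j k i
      unfolding D_def by measurable
    show "Y j r \<in> borel_measurable M" for j r
      unfolding Y_def by measurable
    show "l j r > 0" for j r
      by (auto simp: l_def q_def intro!: mult_pos_pos)
    show "summable (\<lambda>j. 6 * (real j + 1) powr (- (1 + 4 * \<epsilon>)))"
      using \<epsilon> by (intro summable_mult summable_Suc_powr) simp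
    show "summable (\<lambda>r. (1 / (2 * q ^ 4)) ^ r)"
      by (intro summable_geometric) (simp add: q_def power_divide)
    fix j r :: nat
    have "6 * (real j + 1) powr (- (1 + 4 * \<epsilon>)) * (1 / (2 * q ^ 4)) ^ r * l j r =
        6 * ((real j + 1) powr (- (1 + 4 * \<epsilon>)) * (real j + 1) powr (2 + 4 * \<epsilon>)) *
        ((1 / (2 * q ^ 4)) ^ r * (q ^ r) ^ 4)"
      by (simp add: l_def)
    also have "(1 / (2 * q ^ 4)) ^ r * (q ^ r) ^ 4 = (1 / (2 * q ^ 4) * q ^ 4) ^ r"
      by (simp only: power_mult_distrib power_commutes[symmetric] power_mult[symmetric] mult.commute[of 4])
    also have "\<dots> = (1 / 2) ^ r"
      by (simp add: q_def)
    also have "(real j + 1) powr (- (1 + 4 * \<epsilon>)) * (real j + 1) powr (2 + 4 * \<epsilon>) = real j + 1"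
      by (simp add: powr_add[symmetric])
    finally have bound: "6 * (real j + 1) powr (- (1 + 4 * \<epsilon>)) * (1 / (2 * q ^ 4)) ^ r * l j r =
        6 * (real j + 1) * (1 / 2) ^ r" .
    show "(\<integral>\<^sup>+\<omega>. ennreal (Y j r \<omega>) \<partial>M) \<le>
        ennreal (6 * (real j + 1) powr (- (1 + 4 * \<epsilon>)) * (1 / (2 * q ^ 4)) ^ r * l j r)"
    proof (cases "r \<le> j")
      case True
      have "(\<integral>\<^sup>+\<omega>. ennreal (Y j r \<omega>) \<partial>M) = (\<integral>\<^sup>+\<omega>. (\<Sum>i<2 ^ r. ennreal (D j (j - r) i \<omega> ^ 4)) \<partial>M)"
        using True by (simp add: Y_def D_def)
      also have "\<dots> = (\<Sum>i<2 ^ r. \<integral>\<^sup>+\<omega>. ennreal (D j (j - r) i \<omega> ^ 4) \<partial>M)"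
        by (intro nn_integral_sum) measurable
      also have "\<dots> \<le> (\<Sum>i<2 ^ r :: nat. ennreal (6 * (real j + 1) * (1 / 4) ^ r))"
      proof (rule sum_mono)
        show "(\<integral>\<^sup>+\<omega>. ennreal (D j (j - r) i \<omega> ^ 4) \<partial>M) \<le> ennreal (6 * (real j + 1) * (1 / 4) ^ r)" for i
          using S_block_fourth_moment[of "j - r" j i] True by (simp add: D_def)
      qed
      also have "\<dots> = ennreal (2 ^ r * (6 * (real j + 1) * (1 / 4) ^ r))"
        by (subst sum_ennreal) auto
      also have "2 ^ r * (6 * (real j + 1) * (1 / 4) ^ r) = 6 * (real j + 1) * (1 / 2) ^ r"
        by (simp flip: power_mult_distrib)
      finally show ?thesis
        unfolding bound .
    qed (simp add: Y_def)
  qed (auto simp: q_def)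
  then show ?thesis
  proof eventually_elim
    case (elim \<omega>)
    then obtain K where K: "K \<ge> 0" "\<And>j r. Y j r \<omega> \<le> K * l j r"
      by auto
    have "norm (S (2 ^ j + u) \<omega> - S (2 ^ j) \<omega>) \<le> (10 * (K + 1)) * (real j + 1) powr (1 / 2 + \<epsilon>)"
      if u: "u < 2 ^ j" for j u
    proof -
      define C where "C = (K + 1) * (real j + 1) powr (1 / 2 + \<epsilon>)"
      have C: "C \<ge> 0"
        using K by (simp add: C_def)
      have C4: "C ^ 4 = (K + 1) ^ 4 * (real j + 1) powr (2 + 4 * \<epsilon>)"
      proof -
        have "((real j + 1) powr (1 / 2 + \<epsilon>)) ^ 4 = (real j + 1) powr (real 4 * (1 / 2 + \<epsilon>))"
          by (rule powr_power) simp
        also have "real 4 * (1 / 2 + \<epsilon>) = 2 + 4 * \<epsilon>"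
          by simp
        finally show ?thesis
          by (simp only: C_def power_mult_distrib)
      qed
      have "norm (S (2 ^ j + u) \<omega> - S (2 ^ j + 0) \<omega>) \<le> (\<Sum>k<j. C * q ^ (j - k))"
      proof (rule dyadic_chaining[where S = "\<lambda>u. S (2 ^ j + u) \<omega>"])
        fix k i assume k: "k < j" and le: "(i + 1) * 2 ^ k \<le> u"
        \<comment> \<open>This places the increment among the summands of
          \<open>Y j (j - k)\<close>.\<close>
        have "(i + 1) * 2 ^ k < 2 ^ (j - k) * 2 ^ k"
          using le u k by (simp flip: power_add)
        then have "i + 1 < 2 ^ (j - k)"
          by (simp only: mult_less_cancel2)
        then have i: "i < 2 ^ (j - k)"
          by linarith
        have "D j k i \<omega> ^ 4 \<le> Y j (j - k) \<omega>"
          using k i unfolding Y_def by (auto intro!: member_le_sum[where f = "\<lambda>i. D j k i \<omega> ^ 4"])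
        also have "\<dots> \<le> K * l j (j - k)"
          by (rule K(2))
        also have "\<dots> \<le> (K + 1) ^ 4 * ((real j + 1) powr (2 + 4 * \<epsilon>) * (q ^ (j - k)) ^ 4)"
          unfolding l_def
        proof (intro mult_right_mono)
          have "(K + 1) ^ 1 \<le> (K + 1) ^ 4"
            using K by (intro power_increasing) auto
          then show "K \<le> (K + 1) ^ 4"
            by simp
        qed (auto simp: q_def)
        also have "\<dots> = (C * q ^ (j - k)) ^ 4"
          by (simp only: power_mult_distrib C4 mult.assoc)
        finally show "norm (S (2 ^ j + (i + 1) * 2 ^ k) \<omega> - S (2 ^ j + i * 2 ^ k) \<omega>) \<le> C * q ^ (j - k)"
          using C unfolding D_def by (subst (asm) power_mono_iff) (auto simp: q_def)
      qed (use C u in \<open>auto simp: q_def\<close>)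
      also have "\<dots> = C * (\<Sum>k<j. q ^ (j - k))"
        by (simp add: sum_distrib_left)
      also have "\<dots> \<le> C * 10"
      proof (rule mult_left_mono[OF _ C])
        \<comment> \<open>Reversing the order turns the depths \<open>j, ..., 1\<close> into
          \<open>1, ..., j\<close>; the bound 10 is \<open>1 / (1 - q)\<close>.\<close>
        have "(\<Sum>k<j. q ^ (j - k)) = (\<Sum>k<j. q ^ Suc k)"
          by (rule sum.reindex_bij_witness[of _ "\<lambda>k. j - Suc k" "\<lambda>k. j - Suc k"])
            (auto simp: Suc_diff_Suc simp del: power_Suc)
        also have "\<dots> \<le> (\<Sum>k<j. q ^ k)"
          by (intro sum_mono) (simp add: q_def)
        also have "\<dots> \<le> 10"
          using sum_geometric_le[of q j] by (simp add: q_def)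
        finally show "(\<Sum>k<j. q ^ (j - k)) \<le> 10" .
      qed
      finally show ?thesis
        by (simp add: C_def algebra_simps)
    qed
    then show ?case
      using K by (intro exI[of _ "10 * (K + 1)"]) auto
  qed
qed

text \<open>With \<open>2 ^ j\<close> the largest power of two up to \<open>T\<close>, the sum
  splits into its first term, the path along powers of two up to \<open>2 ^ j\<close>, and the part
  inside the last block. Each is at most a constant times a power of \<open>j + 1\<close>, and
  \<open>j + 1\<close> is at most a constant times \<open>ln T\<close>.\<close>

lemma AE_partial_sums_le:
  assumes \<epsilon>: "\<epsilon> > 0"
  shows "AE \<omega> in M. \<exists>K. \<forall>T\<ge>2. norm (weighted_partial_sum (\<lambda>n. F n \<omega>) T) \<le> K * ln T powr (1 / 2 + \<epsilon>)"
  using AE_dyadic_points[OF \<epsilon>] AE_dyadic_blocks[OF \<epsilon>]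
proof eventually_elim
  case (elim \<omega>)
  then obtain K1 K2 where K: "K1 \<ge> 0" "\<And>t. norm (S (2 ^ t) \<omega> - S 1 \<omega>) \<le> K1 * real t powr (1 / 2 + \<epsilon>)"
    "K2 \<ge> 0" "\<And>j u. u < 2 ^ j \<Longrightarrow> norm (S (2 ^ j + u) \<omega> - S (2 ^ j) \<omega>) \<le> K2 * (real j + 1) powr (1 / 2 + \<epsilon>)"
    by blast
  \<comment> \<open>The summand 1 is for \<open>S 1\<close>, and \<open>2 / ln 2\<close> is the
    constant comparing \<open>j + 1\<close> with \<open>ln T\<close>.\<close>
  define K where "K = (1 + K1 + K2) * (2 / ln 2) powr (1 / 2 + \<epsilon>)"
  have "norm (weighted_partial_sum (\<lambda>n. F n \<omega>) T) \<le> K * ln T powr (1 / 2 + \<epsilon>)" if T: "T \<ge> 2" for T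
  proof -
    define n where "n = nat \<lfloor>T\<rfloor>"
    define e where "e = 1 / 2 + \<epsilon>"
    have "{k. 0 < k \<and> real k \<le> T} = {1..n}"
      using T unfolding n_def by (auto simp: le_nat_floor Suc_le_eq le_nat_iff le_floor_iff)
    then have sum_eq: "weighted_partial_sum (\<lambda>n. F n \<omega>) T = S n \<omega>"
      by (simp add: weighted_partial_sum_def S_def)
    have n2: "n \<ge> 2" "real n \<le> T"
      using T unfolding n_def by (auto simp: le_nat_iff le_floor_iff)
    then obtain j where j: "2 ^ j \<le> n" "n < 2 ^ (j + 1)"
      using ex_power_ivl1[of 2 n] by auto
    define u where "u = n - 2 ^ j"
    have u: "n = 2 ^ j + u" "u < 2 ^ j"
      using j by (auto simp: u_def)
    \<comment> \<open>Ensures \<open>j + 1 \<le> 2 * j\<close>, so that the additional 1 is absorbed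
      into a multiple of \<open>ln T\<close>.\<close>
    have "j \<noteq> 0"
      using j n2 by (intro notI) simp
    have "(2::real) ^ j \<le> T"
      using j(1) n2(2) by (metis numeral_power_le_of_nat_cancel_iff order_trans)
    then have "ln (2 ^ j) \<le> ln T"
      using T by (subst ln_le_cancel_iff) auto
    then have "real j * ln 2 \<le> ln T"
      by (simp add: ln_realpow)
    then have j_le: "real j + 1 \<le> 2 / ln 2 * ln T"
    proof -
      have "(real j + 1) * ln 2 \<le> 2 * real j * ln 2"
        using \<open>j \<noteq> 0\<close> by (intro mult_right_mono) auto
      then have "(real j + 1) * ln 2 \<le> 2 * ln T"
        using \<open>real j * ln 2 \<le> ln T\<close> by linarith
      then show ?thesis
        by (simp add: field_simps)
    qed
    have "S 1 \<omega> = 1"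
      by (simp add: S_def F_def multiplicative_extension_def)
    have "S n \<omega> = S 1 \<omega> + (S (2 ^ j) \<omega> - S 1 \<omega>) + (S n \<omega> - S (2 ^ j) \<omega>)"
      by simp
    also have "norm \<dots> \<le> norm (S 1 \<omega>) + norm (S (2 ^ j) \<omega> - S 1 \<omega>) + norm (S n \<omega> - S (2 ^ j) \<omega>)"
      by (intro norm_triangle_le add_mono order.refl)
    also have "\<dots> \<le> 1 * (real j + 1) powr e + K1 * (real j + 1) powr e + K2 * (real j + 1) powr e"
    proof (intro add_mono)
      show "norm (S 1 \<omega>) \<le> 1 * (real j + 1) powr e"
        unfolding \<open>S 1 \<omega> = 1\<close> using \<epsilon> by (simp add: e_def ge_one_powr_ge_zero)
      have "norm (S (2 ^ j) \<omega> - S 1 \<omega>) \<le> K1 * real j powr e"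
        unfolding e_def by (rule K)
      also have "\<dots> \<le> K1 * (real j + 1) powr e"
        using K \<epsilon> by (intro mult_left_mono powr_mono2) (auto simp: e_def)
      finally show "norm (S (2 ^ j) \<omega> - S 1 \<omega>) \<le> K1 * (real j + 1) powr e" .
      show "norm (S n \<omega> - S (2 ^ j) \<omega>) \<le> K2 * (real j + 1) powr e"
        unfolding u(1) e_def by (intro K u)
    qed
    also have "\<dots> = (1 + K1 + K2) * (real j + 1) powr e"
      by (simp add: algebra_simps)
    also have "\<dots> \<le> (1 + K1 + K2) * (2 / ln 2 * ln T) powr e"
      using K \<epsilon> j_le by (intro mult_left_mono powr_mono2) (auto simp: e_def)
    also have "\<dots> = K * ln T powr e"
      by (simp only: K_def e_def powr_mult mult.assoc)
    finally show ?thesis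
      by (simp add: sum_eq e_def)
  qed
  then show ?case
    by blast
qed

end

theorem theorem3:
  fixes M :: "'a measure" and X :: "nat \<Rightarrow> 'a \<Rightarrow> complex" and \<epsilon> :: real
  assumes "prob_space M"
    and "prob_space.indep_vars M (\<lambda>_. borel) X {p. prime p}"
    and "\<And>p. prime p \<Longrightarrow> distr M borel (X p) = uniform_circle"
    and "\<epsilon> > 0"
  shows "AE \<omega> in M. \<exists>K::real. \<forall>T::real. T \<ge> 2 \<longrightarrow>
    norm (weighted_partial_sum (multiplicative_extension (\<lambda>p. X p \<omega>)) T) \<le> K * ln T powr (1/2 + \<epsilon>)"
proof -
  interpret prob_space M
    by (rule assms(1))
  interpret steinhaus M X
    by unfold_locales (use assms in auto)
  show ?thesis
    using AE_partial_sums_le[OF assms(4)] by (simp add: F_def)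
qed

end
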